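(* Let $(a(n))_{n\ge 1}$ be the sequence of positive integers defined by $a(1)=1$, $a(2)=2$, $a(3)=3$, and, for $n\ge 4$, $a(n)$ is the smallest positive integer $m$ such that $m\notin\{a(1),\dots,a(n-1)\}$, $\gcd(m,a(n-2))>1$ and $\gcd(m,a(n-1))=1$. Then $(a(n))_{n\ge 1}$ is a permutation of the natural numbers (positive integers); that is, the map $n\mapsto a(n)$ is a bijection from $\{1,2,3,\dots\}$ to itself.
   Context: Natural numbers here means positive integers. Two integers "have a common factor" when their greatest common divisor is greater than $1$. The sequence is called the Yellowstone permutation (OEIS A098550) and begins $1,2,3,4,9,8,15,14,5,6,25,12,35,16,7,\dots$. *)

theory Defs
  imports "HOL-Computational_Algebra.Primes"
begin

text \<open>
  The sequence is indexed from 1; the value at index 0 is irrelevant and is never used in the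
  recursion. That the set whose \<open>LEAST\<close> is taken is never empty is shown in
  \<open>yellowstone_candidate_exists\<close> below, so \<open>LEAST\<close> really is a minimum.
\<close>

function yellowstone :: "nat \<Rightarrow> nat" where
  "yellowstone n =
    (if n \<le> 3 then n
     else (LEAST m. m > 0 \<and> m \<notin> yellowstone ` {1..<n} \<and>
             gcd m (yellowstone (n - 2)) > 1 \<and> gcd m (yellowstone (n - 1)) = 1))"
  by auto
termination by (relation "measure id") auto

declare yellowstone.simps [simp del]

definition yellowstone_candidate :: "nat \<Rightarrow> nat \<Rightarrow> bool" where
  "yellowstone_candidate n m \<longleftrightarrow> m > 0 \<and> m \<notin> yellowstone ` {1..<n} \<and>
     gcd m (yellowstone (n - 2)) > 1 \<and> gcd m (yellowstone (n - 1)) = 1"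

lemma candidate_exI:
  fixes x y :: nat and A :: "nat set"
  assumes "x > 1" "y > 0" "coprime x y" "finite A"
  shows "\<exists>m. m > 0 \<and> m \<notin> A \<and> gcd m x > 1 \<and> gcd m y = 1"
proof -
  obtain b where b: "\<And>z. z \<in> A \<Longrightarrow> z < b"
    using assms(4) by (meson finite_nat_set_iff_bounded)
  have "b < x ^ b"
    using assms(1) by (simp add: power_gt_expt)
  also have "x ^ b \<le> x ^ Suc b"
    using assms(1) by simp
  finally have "x ^ Suc b \<notin> A"
    using b by fastforce
  moreover have "gcd (x ^ Suc b) x = x"
    by (simp add: gcd_proj2_iff)
  moreover have "gcd (x ^ Suc b) y = 1"
    using assms(3) by (metis coprime_commute coprime_iff_gcd_eq_1 coprime_power_left_iff)
  ultimately show ?thesis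
    using assms(1) by (intro exI[of _ "x ^ Suc b"]) simp
qed

lemma yellowstone_props:
  assumes "n \<ge> 3"
  shows "yellowstone n > 1 \<and> yellowstone (n - 1) > 1 \<and>
         coprime (yellowstone (n - 1)) (yellowstone n)"
  using assms
proof (induction n rule: dec_induct)
  case base
  then show ?case by (simp add: yellowstone.simps coprime_iff_gcd_eq_1 gcd_non_0_nat)
next
  case (step n)
  let ?P = "\<lambda>m. m > 0 \<and> m \<notin> yellowstone ` {1..<Suc n} \<and>
     gcd m (yellowstone (n - 1)) > 1 \<and> gcd m (yellowstone n) = 1"
  have "\<exists>m. ?P m"
    using step.IH by (intro candidate_exI) auto
  moreover have "yellowstone (Suc n) = (LEAST m. ?P m)"
    using step.hyps by (subst yellowstone.simps) (simp add: numeral_2_eq_2)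
  ultimately have P: "?P (yellowstone (Suc n))"
    using LeastI_ex[of ?P] by presburger
  moreover from P have "yellowstone (Suc n) \<noteq> 1"
    by auto
  ultimately show ?case
    using step.IH by (auto simp: coprime_iff_gcd_eq_1 gcd.commute)
qed

lemma yellowstone_candidate_exists:
  assumes "n \<ge> 4"
  shows "\<exists>m. yellowstone_candidate n m"
proof -
  have "n - 1 - 1 = n - 2" "n - 1 \<ge> 3"
    using assms by auto
  then show ?thesis
    using yellowstone_props[of "n - 1"] unfolding yellowstone_candidate_def
    by (intro candidate_exI) auto
qed

lemma yellowstone_is_least:
  assumes "n \<ge> 4"
  shows "yellowstone_candidate n (yellowstone n)"
    and "yellowstone_candidate n m \<Longrightarrow> yellowstone n \<le> m"
proof -
  have eq: "yellowstone n = (LEAST m. yellowstone_candidate n m)"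
    using assms unfolding yellowstone_candidate_def by (subst yellowstone.simps) simp
  show "yellowstone_candidate n (yellowstone n)"
    unfolding eq using yellowstone_candidate_exists[OF assms] by (rule LeastI_ex)
  show "yellowstone_candidate n m \<Longrightarrow> yellowstone n \<le> m"
    unfolding eq by (rule Least_le)
qed

end

theory Submission
  imports Defs
begin

text \<open>
  Injectivity holds by construction, so the terms tend to infinity. Infinitely many primes divide
  terms: if \<open>p\<close> exceeded all of them and \<open>q\<close> divided \<open>a(n - 2)\<close>, then \<open>q p < p\<^sup>2\<close> would be available
  at \<open>n\<close>, which bounds \<open>a(n)\<close>. If \<open>a(n) = k q\<close> is the first term divisible by a large prime \<open>q\<close>, then
  \<open>k\<close> already shares a factor with \<open>a(n - 2)\<close>, so \<open>q\<close> could be replaced by any smaller \<open>r\<close> prime to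
  \<open>a(n - 1)\<close> unless \<open>k r\<close> was used before. Taking for \<open>r\<close> a large power of \<open>p\<close> shows that every
  prime \<open>p\<close> divides infinitely many terms.

  If \<open>k\<close> were missing and a late term \<open>a(n)\<close> shares a factor with \<open>k\<close>, then so does \<open>a(n + 1)\<close>, since
  otherwise \<open>k\<close> would be available at \<open>n + 2\<close>. For prime \<open>k\<close> this contradicts the coprimality of
  consecutive terms, so every prime occurs. For general \<open>k\<close> it follows that all late terms share a
  factor with \<open>k\<close>, but these include primes larger than \<open>k\<close>.
\<close>

lemma yellowstone_gt_1:
  assumes "n \<ge> 2"
  shows "yellowstone n > 1"
proof (cases "n = 2")
  case True
  then show ?thesis by (simp add: yellowstone.simps)
next
  case False
  with assms show ?thesis using yellowstone_props[of n] by simp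
qed

lemma yellowstone_pos:
  assumes "n \<ge> 1"
  shows "yellowstone n > 0"
proof (cases "n = 1")
  case True
  then show ?thesis by (simp add: yellowstone.simps)
next
  case False
  with assms show ?thesis using yellowstone_gt_1[of n] by simp
qed

lemma yellowstone_coprime_Suc:
  assumes "n \<ge> 2"
  shows "coprime (yellowstone n) (yellowstone (Suc n))"
  using yellowstone_props[of "Suc n"] assms by simp

lemma yellowstone_inj: "inj_on yellowstone {1..}"
proof -
  have neq: "yellowstone i \<noteq> yellowstone j" if "1 \<le> i" "i < j" for i j
  proof (cases "j \<le> 3")
    case True
    with that show ?thesis by (simp add: yellowstone.simps)
  next
    case False
    then have "yellowstone_candidate j (yellowstone j)"
      by (intro yellowstone_is_least) simp
    then have "yellowstone j \<notin> yellowstone ` {1..<j}"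
      by (simp add: yellowstone_candidate_def)
    moreover have "yellowstone i \<in> yellowstone ` {1..<j}"
      using that by simp
    ultimately show ?thesis by metis
  qed
  show ?thesis
    by (rule linorder_inj_onI) (use neq in auto)
qed

lemma yellowstone_eventually_gt:
  obtains N where "N \<ge> M" "\<And>n. n \<ge> N \<Longrightarrow> yellowstone n > B"
proof -
  have "finite {n \<in> {1..}. yellowstone n \<le> B}"
    by (rule inj_on_finite[of yellowstone _ "{..B}"])
      (auto intro: inj_on_subset[OF yellowstone_inj])
  then obtain N where N: "\<And>n. n \<ge> 1 \<Longrightarrow> yellowstone n \<le> B \<Longrightarrow> n < N"
    unfolding finite_nat_set_iff_bounded by auto
  show thesis
  proof (rule that[of "max M (Suc N)"])
    show "yellowstone n > B" if "n \<ge> max M (Suc N)" for n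
      using N[of n] that by force
  qed simp
qed

lemma large_prime_dvd_yellowstone:
  obtains q n where "prime q" "q > B" "n \<ge> 1" "q dvd yellowstone n"
proof -
  have "\<exists>q n. prime q \<and> q > B \<and> n \<ge> 1 \<and> q dvd yellowstone n"
  proof (rule ccontr)
    assume "\<not> ?thesis"
    then have small: "q \<le> B" if "prime q" "n \<ge> 1" "q dvd yellowstone n" for q n
      using that by (meson not_le)
    obtain p where p: "prime p" "p > B" using bigger_prime by blast
    have p_ndvd: "\<not> p dvd yellowstone n" if "n \<ge> 1" for n
      using small[OF p(1) that] p(2) by auto
    \<comment> \<open>The bound \<open>p * p\<close> exceeds \<open>q * p\<close> for every prime
      \<open>q < p\<close>, so such a product, once a candidate at \<open>n\<close>, contradicts
      minimality.\<close>
    obtain n where n: "n \<ge> 4" "yellowstone n > p * p"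
      by (rule yellowstone_eventually_gt[of 4 "p * p"]) auto
    have "n - 2 \<ge> 2" using n(1) by linarith
    then have "yellowstone (n - 2) \<noteq> 1"
      using yellowstone_gt_1[of "n - 2"] by simp
    then obtain q where q: "prime q" "q dvd yellowstone (n - 2)"
      using prime_factor_nat by blast
    have "q < p"
      using small[OF q(1) _ q(2)] \<open>n - 2 \<ge> 2\<close> p(2) by linarith
    have "Suc (n - 2) = n - 1" using n(1) by linarith
    then have cop: "coprime (yellowstone (n - 2)) (yellowstone (n - 1))"
      using yellowstone_coprime_Suc[OF \<open>n - 2 \<ge> 2\<close>] by simp
    \<comment> \<open>The factor \<open>p\<close> makes the product new, and \<open>q\<close>
      supplies the common factor with the term at \<open>n - 2\<close>.\<close>
    have "yellowstone_candidate n (q * p)"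
      unfolding yellowstone_candidate_def
    proof (intro conjI)
      show "q * p > 0" using p(1) q(1) by (simp add: prime_gt_0_nat)
      show "q * p \<notin> yellowstone ` {1..<n}"
        using p_ndvd by (metis atLeastLessThan_iff dvd_triv_right imageE)
      have "q dvd gcd (q * p) (yellowstone (n - 2))" using q by simp
      moreover have "gcd (q * p) (yellowstone (n - 2)) > 0"
        using yellowstone_pos[of "n - 2"] n(1) by simp
      ultimately show "gcd (q * p) (yellowstone (n - 2)) > 1"
        using prime_gt_1_nat[OF q(1)] dvd_imp_le by (meson less_le_trans)
      have "coprime q (yellowstone (n - 1))"
        using cop q(2) by (meson coprime_divisors dvd_refl)
      moreover have "coprime p (yellowstone (n - 1))"
        using p_ndvd[of "n - 1"] p(1) n(1) by (intro prime_imp_coprime) auto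
      ultimately show "gcd (q * p) (yellowstone (n - 1)) = 1"
        by (simp add: coprime_iff_gcd_eq_1[symmetric])
    qed
    then have "yellowstone n \<le> q * p"
      using yellowstone_is_least(2) n(1) by blast
    also have "\<dots> \<le> p * p" using \<open>q < p\<close> by simp
    finally show False using n(2) by simp
  qed
  then show thesis using that by blast
qed

text \<open>As \<open>q\<close> is prime to the term at \<open>n - 2\<close>, the factor shared with
  that term lies in \<open>k\<close> and survives in \<open>k * r\<close>. Since
  \<open>k * r < k * q\<close>, minimality leaves only earlier use as a reason for not choosing
  \<open>k * r\<close>.\<close>

lemma yellowstone_cofactor:
  assumes "n \<ge> 4" "prime q" "yellowstone n = k * q" "\<not> q dvd yellowstone (n - 2)"
    and "0 < r" "r < q" "coprime r (yellowstone (n - 1))"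
  shows "k * r \<in> yellowstone ` {1..<n}"
proof (rule ccontr)
  assume new: "\<not> ?thesis"
  have cand: "yellowstone_candidate n (k * q)"
    using yellowstone_is_least(1)[OF assms(1)] assms(3) by simp
  then have "k > 0" by (simp add: yellowstone_candidate_def)
  have "coprime q (yellowstone (n - 2))"
    using assms by (intro prime_imp_coprime)
  then have "gcd (k * q) (yellowstone (n - 2)) = gcd k (yellowstone (n - 2))"
    by (simp add: gcd_mult_left_right_cancel coprime_commute)
  with cand have "gcd k (yellowstone (n - 2)) > 1"
    by (simp add: yellowstone_candidate_def)
  moreover have "gcd k (yellowstone (n - 2)) \<le> gcd (k * r) (yellowstone (n - 2))"
    using yellowstone_pos[of "n - 2"] assms(1) by (intro dvd_imp_le) auto
  moreover have "gcd (k * r) (yellowstone (n - 1)) = 1"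
    using cand assms(7) unfolding yellowstone_candidate_def
    by (metis coprime_iff_gcd_eq_1 coprime_mult_left_iff)
  ultimately have "yellowstone_candidate n (k * r)"
    using new \<open>k > 0\<close> assms(5) by (simp add: yellowstone_candidate_def)
  then have "k * q \<le> k * r"
    using yellowstone_is_least(2)[OF assms(1)] assms(3) by metis
  with \<open>k > 0\<close> assms(6) show False by simp
qed

lemma prime_dvd_late_yellowstone:
  assumes "prime p"
  obtains n where "n \<ge> N" "p dvd yellowstone n"
proof -
  have "\<exists>n\<ge>N. p dvd yellowstone n"
  proof (rule ccontr)
    assume "\<not> ?thesis"
    then have none: "\<not> p dvd yellowstone n" if "n \<ge> N" for n
      using that by blast
    \<comment> \<open>The margin 4 ensures that \<open>n > M\<close> gives both
      \<open>n \<ge> 4\<close> and \<open>n - 1 \<ge> N\<close>.\<close>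
    define M where "M = N + 4"
    define r where "r = p ^ Suc (Max (yellowstone ` {..M}))"
    have r_gt: "yellowstone n < r" if "n \<le> M" for n
    proof -
      have "yellowstone n \<le> Max (yellowstone ` {..M})"
        using that by simp
      also have "\<dots> < r"
        unfolding r_def using power_gt_expt prime_gt_Suc_0_nat[OF assms] by (meson Suc_lessD)
      finally show ?thesis .
    qed
    obtain q m where q: "prime q" "q > r" "m \<ge> 1" "q dvd yellowstone m"
      by (rule large_prime_dvd_yellowstone)
    \<comment> \<open>Taking the first multiple of \<open>q\<close> keeps \<open>q\<close> from
      dividing the term at \<open>n - 2\<close>.\<close>
    define n where "n = (LEAST n. n \<ge> 1 \<and> q dvd yellowstone n)"
    have n: "n \<ge> 1" "q dvd yellowstone n"
      using LeastI[of "\<lambda>n. n \<ge> 1 \<and> q dvd yellowstone n" m] q by (auto simp: n_def)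
    have "n > M"
    proof (rule ccontr)
      assume "\<not> n > M"
      then have "yellowstone n < q" using r_gt[of n] q(2) by simp
      then show False using n dvd_imp_le yellowstone_pos by (meson not_le)
    qed
    have "n - 2 < n" "n - 2 \<ge> 1"
      using \<open>n > M\<close> unfolding M_def by linarith+
    then have "\<not> q dvd yellowstone (n - 2)"
      using not_less_Least[of "n - 2" "\<lambda>n. n \<ge> 1 \<and> q dvd yellowstone n"]
      unfolding n_def[symmetric] by blast
    moreover obtain k where k: "yellowstone n = k * q"
      using n(2) by (metis dvdE mult.commute)
    moreover have "coprime r (yellowstone (n - 1))"
      unfolding r_def using none[of "n - 1"] \<open>n > M\<close> assms
      by (intro coprime_power_left_iff[THEN iffD2] disjI1 prime_imp_coprime) (auto simp: M_def)
    moreover have "r > 0" using r_gt[of 0] by simp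
    ultimately have "k * r \<in> yellowstone ` {1..<n}"
      using yellowstone_cofactor[of n q k r] q \<open>n > M\<close> by (auto simp: M_def)
    then obtain j where j: "j \<ge> 1" "yellowstone j = k * r" by (metis atLeastLessThan_iff imageE)
    \<comment> \<open>A multiple of \<open>p\<close> can only occur early, but all early terms are
      below \<open>r\<close>.\<close>
    have "p dvd yellowstone j" unfolding j(2) r_def by simp
    then have "j \<le> M" using none[of j] unfolding M_def by linarith
    then have "k * r < r" using r_gt[of j] j(2) by simp
    moreover have "k > 0" using k yellowstone_pos[OF n(1)] by simp
    ultimately show False by simp
  qed
  then show thesis using that by blast
qed

lemma yellowstone_shares_factor_Suc:
  assumes "n \<ge> 2" "k > 0" "k \<notin> yellowstone ` {1..}" "yellowstone (n + 2) > k"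
    and "\<not> coprime k (yellowstone n)"
  shows "\<not> coprime k (yellowstone (Suc n))"
proof
  assume "coprime k (yellowstone (Suc n))"
  moreover have "gcd k (yellowstone n) > 1"
    using assms(2,5) by (metis coprime_iff_gcd_eq_1 gcd_pos_nat nat_neq_iff less_one)
  ultimately have "yellowstone_candidate (n + 2) k"
    using assms(2,3) unfolding yellowstone_candidate_def by auto
  then have "yellowstone (n + 2) \<le> k"
    using yellowstone_is_least(2)[of "n + 2" k] assms(1) by simp
  with assms(4) show False by simp
qed

lemma prime_in_yellowstone:
  assumes "prime p"
  shows "p \<in> yellowstone ` {1..}"
proof (rule ccontr)
  assume new: "\<not> ?thesis"
  obtain N where N: "N \<ge> 2" "\<And>n. n \<ge> N \<Longrightarrow> yellowstone n > p"
    using yellowstone_eventually_gt[of 2 p] by blast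
  obtain n where n: "n \<ge> N" "p dvd yellowstone n"
    using prime_dvd_late_yellowstone[OF assms] .
  have "\<not> coprime p (yellowstone n)"
    using n(2) assms by (metis coprime_absorb_left not_prime_unit)
  then have "\<not> coprime p (yellowstone (Suc n))"
    using N n(1) new assms by (intro yellowstone_shares_factor_Suc) (auto simp: prime_gt_0_nat)
  then have "p dvd yellowstone (Suc n)"
    using assms prime_imp_coprime by blast
  with n(2) have "\<not> coprime (yellowstone n) (yellowstone (Suc n))"
    using assms by (meson coprime_common_divisor not_prime_unit)
  with yellowstone_coprime_Suc[of n] N(1) n(1) show False by simp
qed

lemma yellowstone_surj:
  assumes "k > 0"
  shows "k \<in> yellowstone ` {1..}"
proof (rule ccontr)
  assume new: "\<not> ?thesis"
  have "yellowstone 1 = 1" by (simp add: yellowstone.simps)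
  then have "k \<noteq> 1" using new by (metis atLeast_iff imageI order_refl)
  then obtain p where p: "prime p" "p dvd k" using prime_factor_nat by blast
  obtain N where N: "N \<ge> 2" "\<And>n. n \<ge> N \<Longrightarrow> yellowstone n > k"
    using yellowstone_eventually_gt[of 2 k] by blast
  obtain n where n: "n \<ge> N" "p dvd yellowstone n"
    using prime_dvd_late_yellowstone[OF p(1)] .
  have shares: "\<not> coprime k (yellowstone m)" if "m \<ge> n" for m
    using that
  proof (induction m rule: dec_induct)
    case base
    then show ?case using p n(2) by (meson coprime_common_divisor not_prime_unit)
  next
    case (step m)
    then show ?case
      using N n(1) new assms by (intro yellowstone_shares_factor_Suc) auto
  qed
  \<comment> \<open>Exceeding the terms up to \<open>n\<close> puts \<open>q\<close> at a late
    index; exceeding \<open>k\<close> prevents \<open>q\<close> from dividing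
    \<open>k\<close>.\<close>
  obtain q where q: "prime q" "q > Max (insert k (yellowstone ` {..n}))"
    using bigger_prime by blast
  obtain m where m: "yellowstone m = q" using prime_in_yellowstone[OF q(1)] by blast
  have "m \<ge> n"
  proof (rule ccontr)
    assume "\<not> m \<ge> n"
    then have "yellowstone m \<le> Max (insert k (yellowstone ` {..n}))" by (intro Max_ge) auto
    with q(2) m show False by linarith
  qed
  then have "q dvd k"
    using shares[of m] m q(1) prime_imp_coprime coprime_commute by metis
  moreover have "k < q" using q(2) by simp
  ultimately show False using assms dvd_imp_le by (meson not_le)
qed

theorem theorem1:
  shows "bij_betw yellowstone {1..} {1..}"
  unfolding bij_betw_def
proof
  show "yellowstone ` {1..} = {1..}"
    using yellowstone_pos yellowstone_surj by (auto simp: Suc_le_eq)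
qed (rule yellowstone_inj)

end
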